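(* Let $X$ be a Hausdorff space, $D\subset X$ an open set with $\partial D\ne\emptyset$, and $\omega_\cdot^D$ a harmonic measure relative to $D$ which is regular. If $f\in C(\partial D)$ and there exists $y_0\in\partial D$ such that $f(y_0)=\sup_{y\in\partial D}f(y)$, then $$\sup_{x\in D}\omega_x^D(f)=\max_{y\in\partial D}f(y),$$ and if there exists an $x_0\in D$ such that $\omega^D_{x_0}(f)=\sup_{x\in D}\omega_x^D(f)$, then $\omega_x^D(f)$ is constant for $x\in D$.
   Context: Measures: a measure on a set $Y$ is a map $\omega:2^Y\to[0,\infty]$ with $\omega(\emptyset)=0$ and $\omega(A)\le\sum_k\omega(A_k)$ whenever $A\subseteq\bigcup_{k=1}^\infty A_k$ (an outer measure); measurability is in the sense of Carathéodory; it is Borel if every Borel set is measurable. $\nu\ll\mu$ means $\mu(A)=0\Rightarrow\nu(A)=0$ for every $A\subseteq Y$. Write $\omega(f)=\int f\,\mathrm d\omega$. Pre-harmonic measure: a family of Borel measures $\{\omega^D_x:2^{\partial D}\to[0,1]:x\in D\}$ on $\partial D$ such that for every connected component $V$ of $D$: (1) $\omega_x^D(\partial V)=1$ for all $x\in V$; (2) $\omega^D_x\ll\omega^D_y$ for all $x,y\in V$. Harmonic measure: let $\mathcal F_x=\{E\Delta N: E\subseteq\partial D\text{ Borel},\ N\subseteq\partial D,\ \omega_x^D(N)=0\}$ and $\mathcal F=\bigcap_{x\in D}\mathcal F_x$. Extended real-valued functions measurable w.r.t. $\mathcal F$ are called $\omega_\cdot^D$-measurable. The pre-harmonic measure restricted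 to $\mathcal F$ is the harmonic measure $\omega_\cdot^D$ relative to $D$. $L(\partial D;\omega_\cdot^D)$ is the set of $\omega_\cdot^D$-measurable $f$ on $\partial D$ integrable with respect to $\omega_x^D$ for every $x\in D$. A point $y\in\partial D$ is regular if for every $f\in L(\partial D;\omega_\cdot^D)$ continuous at $y$ and every sequence $x_n\to y$ in $D$, $\lim_n\omega_{x_n}^D(f)=f(y)$; $\omega_\cdot^D$ is regular if every $y\in\partial D$ is regular.
   Formalization: The formal version assumes in addition that f is integrable for every ω_x^D and that some sequence in D converges to y_0, and it concludes that ω_x^D(f) is constant on the connected component of D containing x_0 rather than on all of D; the literal claim fails without these changes. *)

theory Defs
  imports "HOL-Analysis.Analysis"
begin

text \<open>
  Measures in the sense of the statement are outer measures, defined on all subsets of a set \<open>Y\<close>;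
  the values of \<open>\<mu>\<close> on sets that are not contained in \<open>Y\<close> are irrelevant.
\<close>

definition outer_measure_on :: "'a set \<Rightarrow> ('a set \<Rightarrow> ennreal) \<Rightarrow> bool" where
  "outer_measure_on Y \<mu> \<longleftrightarrow>
     \<mu> {} = 0 \<and>
     (\<forall>A (B :: nat \<Rightarrow> 'a set). A \<subseteq> Y \<longrightarrow> (\<forall>k. B k \<subseteq> Y) \<longrightarrow> A \<subseteq> (\<Union>k. B k) \<longrightarrow>
        \<mu> A \<le> (\<Sum>k. \<mu> (B k)))"

text \<open>\<open>lambda_system Y (Pow Y) \<mu>\<close> is the family of Caratheodory measurable subsets of \<open>Y\<close>.\<close>

definition borel_outer_measure_on :: "'a::topological_space set \<Rightarrow> ('a set \<Rightarrow> ennreal) \<Rightarrow> bool" where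
  "borel_outer_measure_on Y \<mu> \<longleftrightarrow>
     outer_measure_on Y \<mu> \<and> sets (restrict_space borel Y) \<subseteq> lambda_system Y (Pow Y) \<mu>"

definition absolutely_continuous_on :: "'a set \<Rightarrow> ('a set \<Rightarrow> ennreal) \<Rightarrow> ('a set \<Rightarrow> ennreal) \<Rightarrow> bool" where
  "absolutely_continuous_on Y \<nu> \<mu> \<longleftrightarrow> (\<forall>A\<subseteq>Y. \<mu> A = 0 \<longrightarrow> \<nu> A = 0)"

text \<open>
  The boundary of a component \<open>V\<close> of \<open>D\<close> is taken in the whole space. If the space is locally
  connected it is contained in \<open>frontier D\<close>; in general it need not be, so it is intersected with
  \<open>frontier D\<close>, the set on which \<open>\<omega> x\<close> lives.
\<close>

definition pre_harmonic_measure :: "('a::topological_space \<Rightarrow> 'a set \<Rightarrow> ennreal) \<Rightarrow> 'a set \<Rightarrow> bool" where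
  "pre_harmonic_measure \<omega> D \<longleftrightarrow>
     (\<forall>x\<in>D. borel_outer_measure_on (frontier D) (\<omega> x) \<and> (\<forall>A\<subseteq>frontier D. \<omega> x A \<le> 1)) \<and>
     (\<forall>V\<in>components D.
        (\<forall>x\<in>V. \<omega> x (frontier V \<inter> frontier D) = 1) \<and>
        (\<forall>x\<in>V. \<forall>y\<in>V. absolutely_continuous_on (frontier D) (\<omega> x) (\<omega> y)))"

definition harmonic_sets_at :: "('a::topological_space \<Rightarrow> 'a set \<Rightarrow> ennreal) \<Rightarrow> 'a set \<Rightarrow> 'a \<Rightarrow> 'a set set" where
  "harmonic_sets_at \<omega> D x =
     {sym_diff E N | E N.
        E \<in> sets (restrict_space borel (frontier D)) \<and> N \<subseteq> frontier D \<and> \<omega> x N = 0}"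

definition harmonic_sets :: "('a::topological_space \<Rightarrow> 'a set \<Rightarrow> ennreal) \<Rightarrow> 'a set \<Rightarrow> 'a set set" where
  "harmonic_sets \<omega> D = (\<Inter>x\<in>D. harmonic_sets_at \<omega> D x)"

definition harmonic_measure :: "('a::topological_space \<Rightarrow> 'a set \<Rightarrow> ennreal) \<Rightarrow> 'a set \<Rightarrow> 'a \<Rightarrow> 'a measure" where
  "harmonic_measure \<omega> D x = measure_of (frontier D) (harmonic_sets \<omega> D) (\<omega> x)"

text \<open>
  \<open>measure_of\<close> yields the zero measure unless its arguments form a measure space. The following
  facts show that this does not happen here.
\<close>

lemma outer_measure_on_imp_outer_measure_space:
  assumes "outer_measure_on Y \<mu>"
  shows "outer_measure_space (Pow Y) \<mu>"
proof -
  have e: "\<mu> {} = 0"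
    and c: "\<And>A (B :: nat \<Rightarrow> 'a set). A \<subseteq> Y \<Longrightarrow> (\<And>k. B k \<subseteq> Y) \<Longrightarrow> A \<subseteq> (\<Union>k. B k) \<Longrightarrow>
              \<mu> A \<le> (\<Sum>k. \<mu> (B k))"
    using assms unfolding outer_measure_on_def by blast+
  have "\<mu> A \<le> \<mu> B" if "A \<subseteq> B" "B \<subseteq> Y" for A B
  proof -
    have "\<mu> A \<le> (\<Sum>k. \<mu> (if k = 0 then B else {}))"
    proof (rule c)
      show "A \<subseteq> (\<Union>k::nat. if k = 0 then B else {})" using that by auto
    qed (use that in auto)
    also have "\<dots> = (\<Sum>k\<in>{0::nat}. \<mu> (if k = 0 then B else {}))"
      by (intro suminf_finite) (simp_all add: e)
    finally show ?thesis by simp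
  qed
  moreover have "\<mu> (\<Union>k. B k) \<le> (\<Sum>k. \<mu> (B k))" if "range B \<subseteq> Pow Y" for B :: "nat \<Rightarrow> 'a set"
    by (rule c) (use that in auto)
  ultimately show ?thesis
    unfolding outer_measure_space_def
    by (auto simp: positive_def increasing_def countably_subadditive_def e)
qed

lemma measure_space_lambda_system:
  assumes "outer_measure_on Y \<mu>"
  shows "measure_space Y (lambda_system Y (Pow Y) \<mu>) \<mu>"
proof -
  interpret sigma_algebra Y "Pow Y" by (rule sigma_algebra_Pow)
  show ?thesis
    by (rule caratheodory_lemma[OF outer_measure_on_imp_outer_measure_space[OF assms]])
qed

lemma lambda_system_null:
  assumes "outer_measure_on Y \<mu>" "N \<subseteq> Y" "\<mu> N = 0"
  shows "N \<in> lambda_system Y (Pow Y) \<mu>"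
proof -
  interpret sigma_algebra Y "Pow Y" by (rule sigma_algebra_Pow)
  have oms: "outer_measure_space (Pow Y) \<mu>"
    by (rule outer_measure_on_imp_outer_measure_space[OF assms(1)])
  have mono: "\<mu> A \<le> \<mu> B" if "A \<subseteq> B" "B \<subseteq> Y" for A B
    using oms that unfolding outer_measure_space_def increasing_def by blast
  have sub: "subadditive (Pow Y) \<mu>"
    using oms countably_subadditive_subadditive unfolding outer_measure_space_def by blast
  have "\<mu> (u \<inter> N) + \<mu> (u - N) = \<mu> u" if u: "u \<subseteq> Y" for u
  proof (rule antisym)
    have "\<mu> (u \<inter> N) = 0" using mono[of "u \<inter> N" N] assms by auto
    then show "\<mu> (u \<inter> N) + \<mu> (u - N) \<le> \<mu> u" using mono[of "u - N" u] u by simp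
    have "(u \<inter> N) \<union> (u - N) = u" by blast
    then show "\<mu> u \<le> \<mu> (u \<inter> N) + \<mu> (u - N)"
      using subadditiveD[OF sub, of "u \<inter> N" "u - N"] u by auto
  qed
  then show ?thesis using assms(2) by (auto simp: lambda_system_eq)
qed

lemma harmonic_sets_at_subset_lambda_system:
  assumes "pre_harmonic_measure \<omega> D" "x \<in> D"
  shows "harmonic_sets_at \<omega> D x \<subseteq> lambda_system (frontier D) (Pow (frontier D)) (\<omega> x)"
proof -
  have b: "borel_outer_measure_on (frontier D) (\<omega> x)"
    using assms unfolding pre_harmonic_measure_def by blast
  then have om: "outer_measure_on (frontier D) (\<omega> x)"
    unfolding borel_outer_measure_on_def by blast
  interpret sigma_algebra "frontier D" "lambda_system (frontier D) (Pow (frontier D)) (\<omega> x)"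
    using measure_space_lambda_system[OF om] unfolding measure_space_def by blast
  show ?thesis
    using b lambda_system_null[OF om] unfolding harmonic_sets_at_def borel_outer_measure_on_def
    by blast
qed

lemma sigma_algebra_harmonic_sets_at:
  assumes "pre_harmonic_measure \<omega> D" "x \<in> D"
  shows "sigma_algebra (frontier D) (harmonic_sets_at \<omega> D x)"
proof -
  let ?Y = "frontier D" and ?B = "sets (restrict_space borel (frontier D))"
  have om: "outer_measure_on ?Y (\<omega> x)"
    using assms unfolding pre_harmonic_measure_def borel_outer_measure_on_def by blast
  have sp: "space (restrict_space borel ?Y) = ?Y" by (simp add: space_restrict_space)
  have BY: "E \<subseteq> ?Y" if "E \<in> ?B" for E using sets.sets_into_space[OF that] sp by simp
  have I: "(E - N) \<union> (N - E) \<in> harmonic_sets_at \<omega> D x"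
    if "E \<in> ?B" "N \<subseteq> ?Y" "\<omega> x N = 0" for E N
    using that unfolding harmonic_sets_at_def by blast
  have e: "\<omega> x {} = 0" using om unfolding outer_measure_on_def by blast
  show ?thesis
    unfolding sigma_algebra_iff2
  proof (intro conjI ballI allI impI)
    show "harmonic_sets_at \<omega> D x \<subseteq> Pow ?Y"
      using BY unfolding harmonic_sets_at_def by blast
    show "{} \<in> harmonic_sets_at \<omega> D x" using I[of "{}" "{}"] e by simp
  next
    fix S assume "S \<in> harmonic_sets_at \<omega> D x"
    then obtain E N where S: "S = (E - N) \<union> (N - E)" and E: "E \<in> ?B" and N: "N \<subseteq> ?Y" "\<omega> x N = 0"
      unfolding harmonic_sets_at_def by blast
    have "?Y - E \<in> ?B" using sets.compl_sets[OF E] sp by simp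
    moreover have "?Y - S = ((?Y - E) - N) \<union> (N - (?Y - E))" using N(1) BY[OF E] S by blast
    ultimately show "?Y - S \<in> harmonic_sets_at \<omega> D x" using I[of "?Y - E" N] N by metis
  next
    fix A :: "nat \<Rightarrow> 'a set" assume "range A \<subseteq> harmonic_sets_at \<omega> D x"
    then have "\<forall>i. \<exists>E N. A i = (E - N) \<union> (N - E) \<and> E \<in> ?B \<and> N \<subseteq> ?Y \<and> \<omega> x N = 0"
      unfolding harmonic_sets_at_def by blast
    then obtain E N where A: "\<And>i. A i = (E i - N i) \<union> (N i - E i)" and E: "\<And>i. E i \<in> ?B"
      and N: "\<And>i. N i \<subseteq> ?Y" "\<And>i. \<omega> x (N i) = 0"
      by metis
    let ?E = "\<Union>i. E i"
    let ?N = "((\<Union>i. A i) - ?E) \<union> (?E - (\<Union>i. A i))"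
    have sub: "?N \<subseteq> (\<Union>i. N i)" using A by auto
    have "\<omega> x ?N \<le> (\<Sum>i. \<omega> x (N i))"
      using om sub N(1) unfolding outer_measure_on_def by (meson order_trans UN_least)
    then have "\<omega> x ?N = 0" using N(2) by simp
    moreover have "?N \<subseteq> ?Y" using sub N(1) by blast
    moreover have "?E \<in> ?B" using E by blast
    ultimately have "(?E - ?N) \<union> (?N - ?E) \<in> harmonic_sets_at \<omega> D x" using I by blast
    moreover have "(?E - ?N) \<union> (?N - ?E) = (\<Union>i. A i)" by blast
    ultimately show "(\<Union>i. A i) \<in> harmonic_sets_at \<omega> D x" by metis
  qed
qed

lemma sigma_algebra_harmonic_sets:
  assumes "pre_harmonic_measure \<omega> D" "D \<noteq> {}"
  shows "sigma_algebra (frontier D) (harmonic_sets \<omega> D)"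
  unfolding sigma_algebra_iff2
proof (intro conjI ballI allI impI)
  note sa = sigma_algebra_harmonic_sets_at[OF assms(1), unfolded sigma_algebra_iff2]
  show "harmonic_sets \<omega> D \<subseteq> Pow (frontier D)"
    using sa assms(2) unfolding harmonic_sets_def by blast
  show "{} \<in> harmonic_sets \<omega> D"
    using sa unfolding harmonic_sets_def by blast
  show "frontier D - S \<in> harmonic_sets \<omega> D" if "S \<in> harmonic_sets \<omega> D" for S
    using sa that unfolding harmonic_sets_def by blast
  fix A :: "nat \<Rightarrow> 'a set"
  assume A: "range A \<subseteq> harmonic_sets \<omega> D"
  show "(\<Union>i. A i) \<in> harmonic_sets \<omega> D"
    unfolding harmonic_sets_def
  proof
    fix x assume x: "x \<in> D"
    then have "range A \<subseteq> harmonic_sets_at \<omega> D x" using A unfolding harmonic_sets_def by blast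
    then show "(\<Union>i. A i) \<in> harmonic_sets_at \<omega> D x" using sa[OF x] by blast
  qed
qed

lemma space_harmonic_measure:
  assumes "pre_harmonic_measure \<omega> D" "D \<noteq> {}"
  shows "space (harmonic_measure \<omega> D x) = frontier D"
  using sigma_algebra_harmonic_sets[OF assms] unfolding harmonic_measure_def sigma_algebra_iff2
  by (simp add: space_measure_of)

lemma sets_harmonic_measure:
  assumes "pre_harmonic_measure \<omega> D" "D \<noteq> {}"
  shows "sets (harmonic_measure \<omega> D x) = harmonic_sets \<omega> D"
  unfolding harmonic_measure_def
  by (rule sigma_algebra.sets_measure_of_eq[OF sigma_algebra_harmonic_sets[OF assms]])

lemma emeasure_harmonic_measure:
  assumes "pre_harmonic_measure \<omega> D" "x \<in> D" "A \<in> harmonic_sets \<omega> D"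
  shows "emeasure (harmonic_measure \<omega> D x) A = \<omega> x A"
proof -
  have sub: "harmonic_sets \<omega> D \<subseteq> lambda_system (frontier D) (Pow (frontier D)) (\<omega> x)"
    using harmonic_sets_at_subset_lambda_system[OF assms(1,2)] assms(2)
    unfolding harmonic_sets_def by blast
  have sa: "sigma_algebra (frontier D) (harmonic_sets \<omega> D)"
    using sigma_algebra_harmonic_sets assms(1,2) by blast
  have "outer_measure_on (frontier D) (\<omega> x)"
    using assms unfolding pre_harmonic_measure_def borel_outer_measure_on_def by blast
  then have ms: "measure_space (frontier D) (lambda_system (frontier D) (Pow (frontier D)) (\<omega> x)) (\<omega> x)"
    by (rule measure_space_lambda_system)
  have "positive (harmonic_sets \<omega> D) (\<omega> x)"
    using ms unfolding measure_space_def positive_def by blast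
  moreover have "countably_additive (harmonic_sets \<omega> D) (\<omega> x)"
    using ms sub unfolding measure_space_def countably_additive_def by (meson subset_iff subset_trans)
  ultimately show ?thesis
    unfolding harmonic_measure_def
    using emeasure_measure_of_sigma[OF sa] assms(3) by blast
qed

text \<open>
  The integral of an extended-real-valued function, as the difference of the integrals of its
  positive and negative parts (\<open>e2ennreal\<close> maps negative values to \<open>0\<close>). It is only meaningful if
  one of the two is finite, which holds on \<open>harmonic_L\<close>.
\<close>

definition ereal_integral :: "'a measure \<Rightarrow> ('a \<Rightarrow> ereal) \<Rightarrow> ereal" where
  "ereal_integral M f =
     enn2ereal (\<integral>\<^sup>+ y. e2ennreal (f y) \<partial>M) - enn2ereal (\<integral>\<^sup>+ y. e2ennreal (- f y) \<partial>M)"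

abbreviation harmonic_integral ::
    "('a::topological_space \<Rightarrow> 'a set \<Rightarrow> ennreal) \<Rightarrow> 'a set \<Rightarrow> 'a \<Rightarrow> ('a \<Rightarrow> ereal) \<Rightarrow> ereal" where
  "harmonic_integral \<omega> D x f \<equiv> ereal_integral (harmonic_measure \<omega> D x) f"

text \<open>
  By \<open>sets_harmonic_measure\<close> the measurability condition does not depend on \<open>x\<close>. Functions on
  the boundary are total functions whose values off \<open>frontier D\<close> play no role.
\<close>

definition harmonic_L ::
    "('a::topological_space \<Rightarrow> 'a set \<Rightarrow> ennreal) \<Rightarrow> 'a set \<Rightarrow> ('a \<Rightarrow> ereal) set" where
  "harmonic_L \<omega> D =
     {f. \<forall>x\<in>D. f \<in> borel_measurable (harmonic_measure \<omega> D x) \<and>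
               (\<integral>\<^sup>+ y. e2ennreal \<bar>f y\<bar> \<partial>harmonic_measure \<omega> D x) < \<infinity>}"

definition regular_boundary_point ::
    "('a::t2_space \<Rightarrow> 'a set \<Rightarrow> ennreal) \<Rightarrow> 'a set \<Rightarrow> 'a \<Rightarrow> bool" where
  "regular_boundary_point \<omega> D y \<longleftrightarrow>
     (\<forall>f\<in>harmonic_L \<omega> D. continuous (at y within frontier D) f \<longrightarrow>
        (\<forall>s. (\<forall>n. s n \<in> D) \<longrightarrow> s \<longlonglongrightarrow> y \<longrightarrow> (\<lambda>n. harmonic_integral \<omega> D (s n) f) \<longlonglongrightarrow> f y))"

definition regular_harmonic_measure ::
    "('a::t2_space \<Rightarrow> 'a set \<Rightarrow> ennreal) \<Rightarrow> 'a set \<Rightarrow> bool" where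
  "regular_harmonic_measure \<omega> D \<longleftrightarrow> (\<forall>y\<in>frontier D. regular_boundary_point \<omega> D y)"

end

theory Submission
  imports Defs "HOL-Probability.Probability_Measure"
begin

text \<open>
  Each \<open>\<omega> x\<close> is a probability measure on the boundary, so \<open>\<omega> x(f) \<le> f y0\<close>, and regularity along a
  sequence tending to \<open>y0\<close> gives the converse inequality for the supremum. If \<open>\<omega> x0(f) = f y0\<close>, then
  \<open>f = f y0\<close> holds \<open>\<omega> x0\<close>-almost everywhere, hence \<open>\<omega> x\<close>-almost everywhere for every \<open>x\<close> in the
  component of \<open>x0\<close> by mutual absolute continuity.
\<close>

text \<open>Integrability makes the integrals of both parts finite, so the extended difference is
  the ordinary real one. This gives access to the theory of the Bochner integral.\<close>

lemma ereal_integral_eq_integral: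
  fixes f :: "'a \<Rightarrow> real"
  assumes "integrable M f"
  shows "ereal_integral M (\<lambda>y. ereal (f y)) = ereal (integral\<^sup>L M f)"
proof -
  have fin: "(\<integral>\<^sup>+ y. ennreal (f y) \<partial>M) \<noteq> \<infinity>" "(\<integral>\<^sup>+ y. ennreal (- f y) \<partial>M) \<noteq> \<infinity>"
    using assms by (auto simp: real_integrable_def)
  have ereal_eq: "enn2ereal a = ereal (enn2real a)" if "a \<noteq> \<infinity>" for a :: ennreal
    using that by (cases a) (auto simp: enn2ereal_ennreal)
  show ?thesis
    unfolding ereal_integral_def real_lebesgue_integral_def[OF assms]
    using fin by (simp add: ereal_eq)
qed

text \<open>The mass of the whole boundary is squeezed: it is at least the mass 1 carried by the
  boundary of the component of \<open>x\<close>, by monotonicity of the outer measure, and at most 1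
  by definition.\<close>

lemma prob_space_harmonic_measure:
  assumes pre: "pre_harmonic_measure \<omega> D" and x: "x \<in> D"
  shows "prob_space (harmonic_measure \<omega> D x)"
proof (rule prob_spaceI)
  have ne: "D \<noteq> {}" using x by blast
  let ?V = "connected_component_set D x"
  have V: "?V \<in> components D" and xV: "x \<in> ?V"
    using x by (auto simp: components_def)
  have "\<omega> x (frontier ?V \<inter> frontier D) = 1"
    using pre V xV unfolding pre_harmonic_measure_def by blast
  moreover have "outer_measure_on (frontier D) (\<omega> x)"
    using pre x unfolding pre_harmonic_measure_def borel_outer_measure_on_def by blast
  then have "\<omega> x (frontier ?V \<inter> frontier D) \<le> \<omega> x (frontier D)"
    using outer_measure_on_imp_outer_measure_space
    unfolding outer_measure_space_def increasing_def by blast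
  moreover have "\<omega> x (frontier D) \<le> 1"
    using pre x unfolding pre_harmonic_measure_def by blast
  ultimately have "\<omega> x (frontier D) = 1" by simp
  moreover have "frontier D \<in> harmonic_sets \<omega> D"
    using sets.top[of "harmonic_measure \<omega> D x"]
    by (simp add: space_harmonic_measure[OF pre ne] sets_harmonic_measure[OF pre ne])
  ultimately show "emeasure (harmonic_measure \<omega> D x) (space (harmonic_measure \<omega> D x)) = 1"
    by (simp add: space_harmonic_measure[OF pre ne] emeasure_harmonic_measure[OF pre x])
qed

lemma integrable_harmonic_L:
  fixes f :: "'a::topological_space \<Rightarrow> real"
  assumes "(\<lambda>y. ereal (f y)) \<in> harmonic_L \<omega> D" "x \<in> D"
  shows "integrable (harmonic_measure \<omega> D x) f"
proof (rule integrableI_bounded)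
  have "(\<lambda>y. ereal (f y)) \<in> borel_measurable (harmonic_measure \<omega> D x)"
    and fin: "(\<integral>\<^sup>+ y. e2ennreal \<bar>ereal (f y)\<bar> \<partial>harmonic_measure \<omega> D x) < \<infinity>"
    using assms unfolding harmonic_L_def by blast+
  then show "f \<in> borel_measurable (harmonic_measure \<omega> D x)"
    by (simp add: borel_measurable_ereal_iff)
  show "(\<integral>\<^sup>+ y. ennreal (norm (f y)) \<partial>harmonic_measure \<omega> D x) < \<infinity>"
    using fin by simp
qed

text \<open>Since the total mass is 1, \<open>c - f\<close> has integral \<open>c\<close> minus that
  of \<open>f\<close>; being nonnegative, it has integral 0 exactly if it vanishes almost
  everywhere.\<close>

lemma (in prob_space) integral_eq_upper_bound_iff:
  fixes f :: "'a \<Rightarrow> real"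
  assumes int: "integrable M f" and le: "\<And>y. y \<in> space M \<Longrightarrow> f y \<le> c"
  shows "integral\<^sup>L M f = c \<longleftrightarrow> (AE y in M. f y = c)"
proof -
  have "integral\<^sup>L M (\<lambda>y. c - f y) = c - integral\<^sup>L M f"
    using int by (simp add: prob_space)
  moreover have "integral\<^sup>L M (\<lambda>y. c - f y) = 0 \<longleftrightarrow> (AE y in M. c - f y = 0)"
    using int le by (intro integral_nonneg_eq_0_iff_AE) auto
  moreover have "(AE y in M. c - f y = 0) \<longleftrightarrow> (AE y in M. f y = c)"
    by (intro AE_cong) auto
  ultimately show ?thesis by auto
qed

text \<open>The sigma-algebra \<open>harmonic_sets\<close> is the same for all points of
  \<open>D\<close>, so a measurable null set for \<open>x\<close> covering the exceptional set is
  measurable for \<open>y\<close> too, and null there by absolute continuity.\<close>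

lemma AE_harmonic_measure_transfer:
  assumes pre: "pre_harmonic_measure \<omega> D" and V: "V \<in> components D"
    and x: "x \<in> V" and y: "y \<in> V"
    and ae: "AE z in harmonic_measure \<omega> D x. P z"
  shows "AE z in harmonic_measure \<omega> D y. P z"
proof -
  have xD: "x \<in> D" and yD: "y \<in> D" using V x y in_components_subset by blast+
  then have ne: "D \<noteq> {}" by blast
  note [simp] = space_harmonic_measure[OF pre ne] sets_harmonic_measure[OF pre ne]
  obtain N where N: "{z \<in> frontier D. \<not> P z} \<subseteq> N" "N \<in> harmonic_sets \<omega> D"
      and "emeasure (harmonic_measure \<omega> D x) N = 0"
    using AE_E[OF ae] by auto
  then have "\<omega> x N = 0" by (simp add: emeasure_harmonic_measure[OF pre xD])
  moreover have "N \<subseteq> frontier D"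
    using sets.sets_into_space[of N "harmonic_measure \<omega> D y"] N(2) by simp
  ultimately have "\<omega> y N = 0"
    using pre V x y unfolding pre_harmonic_measure_def absolutely_continuous_on_def by blast
  then show ?thesis
    using N by (intro AE_I[of _ _ N]) (auto simp: emeasure_harmonic_measure[OF pre yD])
qed

theorem theorem2p9:
  fixes D :: "'a::t2_space set"
    and \<omega> :: "'a \<Rightarrow> 'a set \<Rightarrow> ennreal"
    and f :: "'a \<Rightarrow> real"
    and y0 :: 'a
  assumes "open D" and "frontier D \<noteq> {}"
    and "pre_harmonic_measure \<omega> D"
    and "regular_harmonic_measure \<omega> D"
    and "continuous_on (frontier D) f"
    and "(\<lambda>y. ereal (f y)) \<in> harmonic_L \<omega> D"
    and "y0 \<in> frontier D" and "ereal (f y0) = (SUP y\<in>frontier D. ereal (f y))"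
    and "\<exists>s :: nat \<Rightarrow> 'a. (\<forall>n. s n \<in> D) \<and> s \<longlonglongrightarrow> y0"
  shows "(SUP x\<in>D. harmonic_integral \<omega> D x (\<lambda>y. ereal (f y))) = ereal (f y0) \<and>
         (\<forall>x0\<in>D. harmonic_integral \<omega> D x0 (\<lambda>y. ereal (f y)) =
                    (SUP x\<in>D. harmonic_integral \<omega> D x (\<lambda>y. ereal (f y))) \<longrightarrow>
            (\<lambda>x. harmonic_integral \<omega> D x (\<lambda>y. ereal (f y)))
              constant_on connected_component_set D x0)"
proof -
  note pre = assms(3) and fL = assms(6)
  let ?M = "harmonic_measure \<omega> D" and ?I = "\<lambda>x. harmonic_integral \<omega> D x (\<lambda>y. ereal (f y))"
  have fle: "f y \<le> f y0" if "y \<in> frontier D" for y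
  proof -
    have "ereal (f y) \<le> (SUP y\<in>frontier D. ereal (f y))" using that by (rule SUP_upper)
    then show ?thesis by (simp flip: assms(8))
  qed
  note prob = prob_space_harmonic_measure[OF pre]
  have sp: "space (?M x) = frontier D" if "x \<in> D" for x
    using that by (intro space_harmonic_measure[OF pre]) blast
  have I: "?I x = ereal (integral\<^sup>L (?M x) f)" if "x \<in> D" for x
    by (rule ereal_integral_eq_integral[OF integrable_harmonic_L[OF fL that]])
  have I_le: "?I x \<le> ereal (f y0)" if "x \<in> D" for x
  proof -
    interpret prob_space "?M x" by (rule prob[OF that])
    have "integral\<^sup>L (?M x) f \<le> f y0"
      using integrable_harmonic_L[OF fL that] fle sp[OF that] by (intro integral_le_const) auto
    then show ?thesis by (simp add: I[OF that])
  qed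
  \<comment> \<open>Used in both directions: left to right at \<open>x0\<close>, right to left at
    the other points of its component.\<close>
  have I_eq: "?I x = ereal (f y0) \<longleftrightarrow> (AE y in ?M x. f y = f y0)" if "x \<in> D" for x
    using prob_space.integral_eq_upper_bound_iff[OF prob[OF that] integrable_harmonic_L[OF fL that]]
      fle sp[OF that] by (simp add: I[OF that])
  \<comment> \<open>Regularity speaks of sequences, and without first countability a frontier point
    need not be a sequential limit of points of \<open>D\<close>; the sequence is therefore taken
    from the hypotheses.\<close>
  obtain s where s: "\<And>n::nat. s n \<in> D" "s \<longlonglongrightarrow> y0" using assms(9) by blast
  have "continuous (at y0 within frontier D) (\<lambda>y. ereal (f y))"
    using assms(5,7) by (auto simp: continuous_on_def continuous_within)
  then have "(\<lambda>n. ?I (s n)) \<longlonglongrightarrow> ereal (f y0)"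
    using assms(4,7) fL s unfolding regular_harmonic_measure_def regular_boundary_point_def by blast
  moreover have "?I (s n) \<le> (SUP x\<in>D. ?I x)" for n using s(1) by (rule SUP_upper)
  ultimately have "ereal (f y0) \<le> (SUP x\<in>D. ?I x)" by (intro LIMSEQ_le_const2) blast+
  with I_le have sup: "(SUP x\<in>D. ?I x) = ereal (f y0)" by (intro antisym SUP_least)
  \<comment> \<open>Absolute continuity relates only points of one component, so constancy is
    obtained on the component of \<open>x0\<close>, with value \<open>f y0\<close>.\<close>
  moreover have "?I constant_on connected_component_set D x0"
    if x0: "x0 \<in> D" and eq: "?I x0 = (SUP x\<in>D. ?I x)" for x0
    unfolding constant_on_def
  proof (intro exI ballI)
    fix x assume x: "x \<in> connected_component_set D x0"
    then have xD: "x \<in> D" using connected_component_subset by blast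
    have "AE y in ?M x. f y = f y0"
    proof (rule AE_harmonic_measure_transfer[OF pre _ _ x])
      show "connected_component_set D x0 \<in> components D" "x0 \<in> connected_component_set D x0"
        using x0 by (auto simp: components_def)
      show "AE y in ?M x0. f y = f y0" using eq sup I_eq[OF x0] by simp
    qed
    then show "?I x = ereal (f y0)" using I_eq[OF xD] by simp
  qed
  ultimately show ?thesis by blast
qed

end
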